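(* Assume the P-ideal dichotomy (PID). Then no construction scheme $\mathcal{F}$ over $\omega_1$ is 2-capturing.
   Context: PID: for every set $X$ and every ideal $\mathcal{I}$ with $[X]^{<\omega}\subseteq\mathcal{I}\subseteq[X]^{\le\omega}$ which is a P-ideal (every countable $\mathcal{A}\subseteq\mathcal{I}$ has $B\in\mathcal{I}$ with $A\setminus B$ finite for all $A\in\mathcal{A}$), either there is $Y\in[X]^{\omega_1}$ with $[Y]^{\omega}\subseteq\mathcal{I}$, or $X$ is a countable union of sets in $\mathcal{I}^\perp=\{Z\subseteq X: Z\cap B\text{ finite for all }B\in\mathcal{I}\}$. Types: $\tau=\langle m_k,n_{k+1},r_{k+1}\rangle_{k\in\omega}$ with $m_0=1$, $n_{k+1}\ge2$, $m_k>r_{k+1}$, $m_{k+1}=r_{k+1}+(m_k-r_{k+1})n_{k+1}$, assumed good (each $r$ equals $r_k$ for infinitely many $k$). A construction scheme of type $\tau$ is a family $\mathcal{F}$ of nonempty finite subsets of $\omega_1$, cofinal under $\subseteq$, each of size some $m_k$, such that with $\mathcal{F}_k=\{F\in\mathcal{F}:|F|=m_k\}$: (i) for $E,F\in\mathcal{F}_k$, $E\cap F$ is an initial segment of both; (ii) each $F\in\mathcal{F}_{k+1}$ is $F_0\cup\dots\cup F_{n_{k+1}-1}$ with $F_i\in\mathcal{F}_k$ a $\Delta$-system with root $R(F)$, $|R(F)|=r_{k+1}$, $R(F)<F_0\setminus R(F)<\dots<F_{n_{k+1}-1}\setminus R(F)$. Let $\rho(\alpha,\beta)=\min\{k:\exists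 F\in\mathcal{F}_k\ \{\alpha,\beta\}\subseteq F\}$; $\|\alpha\|_k=|\{\xi<\alpha:\rho(\alpha,\xi)\le k\}|$, $\Delta(\alpha,\beta)=\min\{k:\|\alpha\|_k\ne\|\beta\|_k\}$. $\Xi_\alpha(0)=0$; for $k\ge1$ and $F\in\mathcal{F}_k$ containing $\alpha$, $\Xi_\alpha(k)=-1$ if $\alpha\in R(F)$, $=i$ if $\alpha\in F_i\setminus R(F)$. $D(a)$ is the $a$-th element of a finite set $D$ of ordinals. A family $\langle D_i\rangle_{i<n}$ of subsets of $\omega_1$ each of size $m$ forming a root-tail-tail $\Delta$-system (pairwise intersections equal a root $R$, $|R|=r$, $R<D_i\setminus R$, $D_0\setminus R<D_1\setminus R<\dots$) is captured at level $l$ if $\Xi_{D_i(a)}(l)=-1$ for $a<r$, $=i$ for $r\le a<m$, and $\rho(D_i(a),D_j(a))=l=\Delta(D_i(a),D_j(a))$ for $i<j<n$, $r\le a<m$. $\mathcal{F}$ is 2-capturing if for every uncountable family $\mathcal{S}$ of finite subsets of $\omega_1$ there are infinitely many $l$ such that some two members of $\mathcal{S}$ form a family captured at level $l$. *)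

theory Defs
  imports "HOL-Library.Countable_Set_Type"
begin

section \<open>The ordinal \<open>\<omega>\<^sub>1\<close>\<close>

text \<open>
  \<^term>\<open>cardSuc natLeq\<close> is the least well-order whose cardinality exceeds that of
  \<^term>\<open>natLeq\<close>, i.e. a well-order of type \<open>\<omega>\<^sub>1\<close>. The lemmas
  \<open>countable_below_omega1\<close> and \<open>uncountable_omega1\<close> below characterise it up to isomorphism.
\<close>

typedef omega1 = "Field (cardSuc natLeq)"
  using Field_cardSuc_not_empty[OF natLeq_Card_order] by blast

instantiation omega1 :: wellorder
begin

definition less_eq_omega1 :: "omega1 \<Rightarrow> omega1 \<Rightarrow> bool" where
  "x \<le> y \<longleftrightarrow> (Rep_omega1 x, Rep_omega1 y) \<in> cardSuc natLeq"

definition less_omega1 :: "omega1 \<Rightarrow> omega1 \<Rightarrow> bool" where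
  "x < y \<longleftrightarrow> x \<le> y \<and> x \<noteq> (y :: omega1)"

instance
proof -
  let ?r = "cardSuc natLeq"
  have wo: "Well_order ?r"
    using cardSuc_Card_order[OF natLeq_Card_order] by (simp add: card_order_on_def)
  then have refl: "Refl ?r" and trans: "trans ?r" and anti: "antisym ?r"
    and tot: "Total ?r" and wf: "wf (?r - Id)"
    by (auto simp: order_on_defs)
  have le_refl: "x \<le> x" for x :: omega1
    using refl Rep_omega1 by (auto simp: less_eq_omega1_def refl_on_def)
  have le_trans: "x \<le> y \<Longrightarrow> y \<le> z \<Longrightarrow> x \<le> z" for x y z :: omega1
    using trans unfolding less_eq_omega1_def by (rule transD)
  have le_anti: "x \<le> y \<Longrightarrow> y \<le> x \<Longrightarrow> x = y" for x y :: omega1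
    using anti unfolding less_eq_omega1_def by (metis antisymD Rep_omega1_inject)
  have le_tot: "x \<le> y \<or> y \<le> x" for x y :: omega1
  proof (cases "x = y")
    case False
    then have "Rep_omega1 x \<noteq> Rep_omega1 y" by (simp add: Rep_omega1_inject)
    with tot show ?thesis
      using Rep_omega1[of x] Rep_omega1[of y] by (auto simp: less_eq_omega1_def total_on_def)
  qed (simp add: le_refl)
  have "{(x, y). x < y} \<subseteq> inv_image (?r - Id) Rep_omega1"
    by (auto simp: less_omega1_def less_eq_omega1_def Rep_omega1_inject)
  then have wf_less: "wf {(x, y :: omega1). x < y}"
    using wf wf_inv_image wf_subset by blast
  show "OFCLASS(omega1, wellorder_class)"
  proof
    fix x y z :: omega1 and P :: "omega1 \<Rightarrow> bool" and a :: omega1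
    show "x < y \<longleftrightarrow> x \<le> y \<and> \<not> y \<le> x"
      using le_anti le_refl by (auto simp: less_omega1_def)
    show "x \<le> x" by (rule le_refl)
    show "x \<le> y \<Longrightarrow> y \<le> z \<Longrightarrow> x \<le> z" by (rule le_trans)
    show "x \<le> y \<Longrightarrow> y \<le> x \<Longrightarrow> x = y" by (rule le_anti)
    show "x \<le> y \<or> y \<le> x" by (rule le_tot)
    show "(\<And>x. (\<And>y. y < x \<Longrightarrow> P y) \<Longrightarrow> P x) \<Longrightarrow> P a"
      using wf_induct_rule[OF wf_less, of P a] by blast
  qed
qed

end

lemma uncountable_omega1:
  includes cardinal_syntax
  shows "uncountable (UNIV :: omega1 set)"
proof
  let ?r = "cardSuc natLeq"
  assume "countable (UNIV :: omega1 set)"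
  then have "countable (Rep_omega1 ` UNIV)" by (rule countable_image)
  moreover have "range Rep_omega1 = Field ?r"
    using type_definition.Rep_range[OF type_definition_omega1] .
  ultimately have "countable (Field ?r)" by simp
  then have "|Field ?r| \<le>o natLeq"
    using countable_card_le_natLeq by blast
  moreover have "natLeq <o ?r" by (rule cardSuc_greater[OF natLeq_Card_order])
  moreover have "|Field ?r| =o ?r"
    by (rule card_of_Field_ordIso[OF cardSuc_Card_order[OF natLeq_Card_order]])
  ultimately have "natLeq <o natLeq"
    using ordLess_ordIso_trans[OF _ ordIso_symmetric] ordLess_ordLeq_trans by blast
  then show False by (simp add: ordLess_irreflexive)
qed

lemma countable_below_omega1:
  includes cardinal_syntax
  shows "countable {x :: omega1. x < a}"
proof -
  let ?r = "cardSuc natLeq"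
  have co: "Card_order ?r" by (rule cardSuc_Card_order[OF natLeq_Card_order])
  have "|underS ?r (Rep_omega1 a)| <o ?r"
    by (rule card_of_underS[OF co Rep_omega1])
  then have "|underS ?r (Rep_omega1 a)| \<le>o natLeq"
    by (simp add: cardSuc_ordLeq_ordLess[OF natLeq_Card_order card_of_Card_order])
  then have "countable (underS ?r (Rep_omega1 a))"
    using countable_card_le_natLeq by blast
  moreover have "Rep_omega1 ` {x. x < a} \<subseteq> underS ?r (Rep_omega1 a)"
    by (auto simp: underS_def less_omega1_def less_eq_omega1_def Rep_omega1_inject)
  ultimately have "countable (Rep_omega1 ` {x. x < a})"
    using countable_subset by blast
  then show ?thesis
    by (rule countable_image_inj_on) (simp add: inj_on_def Rep_omega1_inject)
qed


section \<open>The P-ideal dichotomy\<close>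

definition ideal_on :: "'b set \<Rightarrow> 'b set set \<Rightarrow> bool" where
  "ideal_on X I \<longleftrightarrow>
     I \<subseteq> Pow X \<and> {} \<in> I \<and>
     (\<forall>A\<in>I. \<forall>B. B \<subseteq> A \<longrightarrow> B \<in> I) \<and>
     (\<forall>A\<in>I. \<forall>B\<in>I. A \<union> B \<in> I)"

definition P_ideal_on :: "'b set \<Rightarrow> 'b set set \<Rightarrow> bool" where
  "P_ideal_on X I \<longleftrightarrow>
     ideal_on X I \<and>
     (\<forall>\<A>. countable \<A> \<and> \<A> \<subseteq> I \<longrightarrow> (\<exists>B\<in>I. \<forall>A\<in>\<A>. finite (A - B)))"

definition orth :: "'b set \<Rightarrow> 'b set set \<Rightarrow> 'b set set" where
  "orth X I = {Z. Z \<subseteq> X \<and> (\<forall>B\<in>I. finite (Z \<inter> B))}"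

text \<open>The instance of PID for one underlying set \<open>X\<close>; PID asserts it for all sets.\<close>

definition P_ideal_dichotomy_on :: "'b set \<Rightarrow> bool" where
  "P_ideal_dichotomy_on X \<longleftrightarrow>
     (\<forall>I. P_ideal_on X I \<and> {A. A \<subseteq> X \<and> finite A} \<subseteq> I \<and> I \<subseteq> {A. A \<subseteq> X \<and> countable A} \<longrightarrow>
        (\<exists>Y\<subseteq>X. (\<exists>f. bij_betw f (UNIV :: omega1 set) Y) \<and>
                {A. A \<subseteq> Y \<and> countable A \<and> infinite A} \<subseteq> I) \<or>
        (\<exists>\<C>. countable \<C> \<and> \<C> \<subseteq> orth X I \<and> \<Union>\<C> = X))"


section \<open>Construction schemes\<close>

text \<open>
  A type is given by three sequences \<open>m\<close>, \<open>n\<close>, \<open>r\<close>; the values \<open>n 0\<close> and \<open>r 0\<close> play no role.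
\<close>

definition scheme_type :: "(nat \<Rightarrow> nat) \<Rightarrow> (nat \<Rightarrow> nat) \<Rightarrow> (nat \<Rightarrow> nat) \<Rightarrow> bool" where
  "scheme_type m n r \<longleftrightarrow>
     m 0 = 1 \<and>
     (\<forall>k. n (Suc k) \<ge> 2 \<and> m k > r (Suc k) \<and>
          m (Suc k) = r (Suc k) + (m k - r (Suc k)) * n (Suc k))"

definition good_type :: "(nat \<Rightarrow> nat) \<Rightarrow> (nat \<Rightarrow> nat) \<Rightarrow> (nat \<Rightarrow> nat) \<Rightarrow> bool" where
  "good_type m n r \<longleftrightarrow> scheme_type m n r \<and> (\<forall>x. infinite {k. r (Suc k) = x})"

definition set_below :: "omega1 set \<Rightarrow> omega1 set \<Rightarrow> bool" where
  "set_below A B \<longleftrightarrow> (\<forall>x\<in>A. \<forall>y\<in>B. x < y)"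

definition initial_segment :: "omega1 set \<Rightarrow> omega1 set \<Rightarrow> bool" where
  "initial_segment A B \<longleftrightarrow> A \<subseteq> B \<and> (\<forall>x\<in>A. \<forall>y\<in>B. y < x \<longrightarrow> y \<in> A)"

text \<open>Root-tail-tail \<open>\<Delta>\<close>-system \<open>D 0, \<dots>, D (N - 1)\<close> with root \<open>R\<close>.\<close>

definition rtt_system :: "nat \<Rightarrow> (nat \<Rightarrow> omega1 set) \<Rightarrow> omega1 set \<Rightarrow> bool" where
  "rtt_system N D R \<longleftrightarrow>
     (\<forall>i<N. R \<subseteq> D i) \<and>
     (\<forall>j<N. \<forall>i<j. D i \<inter> D j = R) \<and>
     (\<forall>i<N. set_below R (D i - R)) \<and>
     (\<forall>j<N. \<forall>i<j. set_below (D i - R) (D j - R))"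

definition level :: "(nat \<Rightarrow> nat) \<Rightarrow> omega1 set set \<Rightarrow> nat \<Rightarrow> omega1 set set" where
  "level m \<F> k = {F \<in> \<F>. card F = m k}"

text \<open>
  \<open>E 0, \<dots>, E (n (Suc k) - 1)\<close> is the decomposition with root \<open>R\<close> of the set \<open>F\<close>
  of level \<open>Suc k\<close>. For \<open>F\<close>, \<open>k\<close> fixed, the sizes and the order requirements leave at most one
  choice for \<open>R\<close> and for the \<open>E i\<close> with \<open>i < n (Suc k)\<close>.
\<close>

definition decomposition ::
  "(nat \<Rightarrow> nat) \<Rightarrow> (nat \<Rightarrow> nat) \<Rightarrow> (nat \<Rightarrow> nat) \<Rightarrow> omega1 set set \<Rightarrow> nat \<Rightarrow>
   omega1 set \<Rightarrow> (nat \<Rightarrow> omega1 set) \<Rightarrow> omega1 set \<Rightarrow> bool" where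
  "decomposition m n r \<F> k F E R \<longleftrightarrow>
     (\<forall>i<n (Suc k). E i \<in> level m \<F> k) \<and>
     F = (\<Union>i<n (Suc k). E i) \<and>
     rtt_system (n (Suc k)) E R \<and>
     card R = r (Suc k)"

definition construction_scheme ::
  "(nat \<Rightarrow> nat) \<Rightarrow> (nat \<Rightarrow> nat) \<Rightarrow> (nat \<Rightarrow> nat) \<Rightarrow> omega1 set set \<Rightarrow> bool" where
  "construction_scheme m n r \<F> \<longleftrightarrow>
     (\<forall>F\<in>\<F>. finite F \<and> F \<noteq> {}) \<and>
     (\<forall>A. finite A \<longrightarrow> (\<exists>F\<in>\<F>. A \<subseteq> F)) \<and>
     (\<forall>F\<in>\<F>. \<exists>k. card F = m k) \<and>
     (\<forall>k. \<forall>E\<in>level m \<F> k. \<forall>F\<in>level m \<F> k.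
        initial_segment (E \<inter> F) E \<and> initial_segment (E \<inter> F) F) \<and>
     (\<forall>k. \<forall>F\<in>level m \<F> (Suc k). \<exists>E R. decomposition m n r \<F> k F E R)"

definition rho :: "(nat \<Rightarrow> nat) \<Rightarrow> omega1 set set \<Rightarrow> omega1 \<Rightarrow> omega1 \<Rightarrow> nat" where
  "rho m \<F> \<alpha> \<beta> = (LEAST k. \<exists>F\<in>level m \<F> k. {\<alpha>, \<beta>} \<subseteq> F)"

definition norm_at :: "(nat \<Rightarrow> nat) \<Rightarrow> omega1 set set \<Rightarrow> omega1 \<Rightarrow> nat \<Rightarrow> nat" where
  "norm_at m \<F> \<alpha> k = card {\<xi>. \<xi> < \<alpha> \<and> rho m \<F> \<alpha> \<xi> \<le> k}"

definition Delta :: "(nat \<Rightarrow> nat) \<Rightarrow> omega1 set set \<Rightarrow> omega1 \<Rightarrow> omega1 \<Rightarrow> nat" where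
  "Delta m \<F> \<alpha> \<beta> = (LEAST k. norm_at m \<F> \<alpha> k \<noteq> norm_at m \<F> \<beta> k)"

text \<open>
  In a construction scheme the value of \<open>\<Xi>\<^sub>\<alpha>(k)\<close> does not depend on the set \<open>F\<close> of level \<open>k\<close>
  containing \<open>\<alpha>\<close> by which it is computed.
\<close>

fun Xi ::
  "(nat \<Rightarrow> nat) \<Rightarrow> (nat \<Rightarrow> nat) \<Rightarrow> (nat \<Rightarrow> nat) \<Rightarrow> omega1 set set \<Rightarrow> omega1 \<Rightarrow> nat \<Rightarrow> int" where
  "Xi m n r \<F> \<alpha> 0 = 0"
| "Xi m n r \<F> \<alpha> (Suc k) =
     (THE x. \<exists>F E R. F \<in> level m \<F> (Suc k) \<and> \<alpha> \<in> F \<and> decomposition m n r \<F> k F E R \<and>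
        (\<alpha> \<in> R \<and> x = - 1 \<or> (\<exists>i<n (Suc k). \<alpha> \<in> E i - R \<and> x = int i)))"

text \<open>\<open>elt D a\<close> is the \<open>a\<close>-th element, counted from \<open>0\<close>, of the finite set \<open>D\<close> in increasing order.\<close>

definition elt :: "omega1 set \<Rightarrow> nat \<Rightarrow> omega1" where
  "elt D a = sorted_list_of_set D ! a"

definition captured ::
  "(nat \<Rightarrow> nat) \<Rightarrow> (nat \<Rightarrow> nat) \<Rightarrow> (nat \<Rightarrow> nat) \<Rightarrow> omega1 set set \<Rightarrow>
   nat \<Rightarrow> (nat \<Rightarrow> omega1 set) \<Rightarrow> nat \<Rightarrow> bool" where
  "captured m n r \<F> N D l \<longleftrightarrow>
     (\<exists>s R. (\<forall>i<N. finite (D i) \<and> card (D i) = s) \<and> rtt_system N D R \<and>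
        (\<forall>i<N. \<forall>a<card R. Xi m n r \<F> (elt (D i) a) l = - 1) \<and>
        (\<forall>i<N. \<forall>a\<in>{card R..<s}. Xi m n r \<F> (elt (D i) a) l = int i) \<and>
        (\<forall>j<N. \<forall>i<j. \<forall>a\<in>{card R..<s}.
           rho m \<F> (elt (D i) a) (elt (D j) a) = l \<and>
           Delta m \<F> (elt (D i) a) (elt (D j) a) = l))"

definition two_capturing ::
  "(nat \<Rightarrow> nat) \<Rightarrow> (nat \<Rightarrow> nat) \<Rightarrow> (nat \<Rightarrow> nat) \<Rightarrow> omega1 set set \<Rightarrow> bool" where
  "two_capturing m n r \<F> \<longleftrightarrow>
     (\<forall>\<S>. uncountable \<S> \<and> (\<forall>D\<in>\<S>. finite D) \<longrightarrow>
        infinite {l. \<exists>D. D 0 \<in> \<S> \<and> D 1 \<in> \<S> \<and> D 0 \<noteq> D 1 \<and> captured m n r \<F> 2 D l})"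

end

theory Submission
  imports Defs
begin

text \<open>
  For ordinals \<open>\<alpha>\<close>, \<open>\<beta>\<close> let \<open>clash \<alpha> \<beta>\<close> be the set of \<open>k\<close> with
  \<open>\<Xi>\<^sub>\<alpha>(k+1) = 0\<close>, \<open>\<Xi>\<^sub>\<beta>(k+1) = 1\<close> and \<open>\<parallel>\<alpha>\<parallel>\<^sub>k < \<parallel>\<beta>\<parallel>\<^sub>k\<close>. It is finite for \<open>\<alpha> < \<beta>\<close>, and it
  increases modulo finite sets with \<open>\<beta>\<close>, uniformly in \<open>\<alpha>\<close>. Hence the countable \<open>A\<close> on which
  \<open>clash \<alpha> \<beta>\<close> tends to infinity for some \<open>\<beta>\<close> form a P-ideal. Both alternatives of the dichotomy
  contradict 2-capturing.

  If all countable subsets of an uncountable \<open>Y\<close> are in the ideal, choose \<open>\<gamma>\<^sub>\<xi> < \<alpha>\<^sub>\<xi> \<in> Y\<close> recursively so that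
  \<open>clash \<alpha>\<^sub>\<eta> \<gamma>\<^sub>\<xi>\<close> (\<open>\<eta> < \<xi>\<close>) tends to infinity. After thinning out, \<open>\<rho>(\<gamma>\<^sub>\<xi>, \<alpha>\<^sub>\<xi>) = N\<close> is constant and
  no \<open>clash \<alpha>\<^sub>\<eta> \<gamma>\<^sub>\<xi>\<close> is bounded by \<open>N\<close>; but if \<open>{\<gamma>\<^sub>\<eta>, \<alpha>\<^sub>\<eta>}\<close>, \<open>{\<gamma>\<^sub>\<xi>, \<alpha>\<^sub>\<xi>}\<close> are captured at a level
  above \<open>N\<close>, then \<open>\<parallel>\<alpha>\<^sub>\<eta>\<parallel>\<^sub>k = \<parallel>\<alpha>\<^sub>\<xi>\<parallel>\<^sub>k > \<parallel>\<gamma>\<^sub>\<xi>\<parallel>\<^sub>k\<close> for all relevant \<open>k \<ge> N\<close>. If an uncountable \<open>Z\<close> is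
  orthogonal, then for each \<open>\<beta>\<close> the sets \<open>clash \<alpha> \<beta>\<close> with \<open>\<alpha> \<in> Z\<close>, \<open>\<alpha> < \<beta>\<close> have a common bound, which is
  constant for uncountably many \<open>\<beta>\<close>; capturing pairs \<open>\<alpha>\<^sub>\<xi> < \<beta>\<^sub>\<xi>\<close> at a high level exceeds it.
\<close>

section \<open>Uncountable subsets of \<open>\<omega>\<^sub>1\<close>\<close>

lemma countable_atMost_omega1: "countable {..a :: omega1}"
proof -
  have "{..a} = insert a {x. x < a}" by auto
  then show ?thesis using countable_below_omega1 by simp
qed

lemma countable_strict_bound_omega1:
  fixes C :: "omega1 set"
  assumes "countable C"
  shows "\<exists>b. \<forall>x\<in>C. x < b"
proof -
  have "countable (\<Union>x\<in>C. {..x})" using assms countable_atMost_omega1 by blast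
  then obtain b where "b \<notin> (\<Union>x\<in>C. {..x})" using uncountable_omega1 by (metis UNIV_eq_I)
  then show ?thesis by (auto simp: not_le)
qed

lemma uncountable_unbounded_omega1:
  fixes Y :: "omega1 set"
  assumes "uncountable Y"
  shows "\<exists>y\<in>Y. b < y"
proof (rule ccontr)
  assume "\<not> ?thesis"
  then have "Y \<subseteq> {..b}" by (auto simp: not_less)
  then show False using assms countable_atMost_omega1 countable_subset by blast
qed

lemma uncountable_fiber:
  fixes g :: "'a \<Rightarrow> 'c::countable"
  assumes "uncountable U"
  shows "\<exists>c. uncountable {x\<in>U. g x = c}"
proof (rule ccontr)
  assume "\<not> ?thesis"
  then have "countable (\<Union>c. {x\<in>U. g x = c})" by (intro countable_UN) auto
  moreover have "U \<subseteq> (\<Union>c. {x\<in>U. g x = c})" by auto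
  ultimately show False using assms countable_subset by blast
qed

text \<open>Builds the sequences of pairs in both alternatives. The requirement \<open>Q\<close>
  sees only the set of earlier values, which is countable at every stage.\<close>

lemma omega1_recursion:
  assumes "\<And>C :: 'a set. countable C \<Longrightarrow> \<exists>x. Q C x"
  shows "\<exists>f :: omega1 \<Rightarrow> 'a. \<forall>\<xi>. Q (f ` {..<\<xi>}) (f \<xi>)"
proof (rule dependent_wellorder_choice[where P = "\<lambda>f \<xi> x. Q (f ` {..<\<xi>}) x"])
  fix r :: 'a and f g :: "omega1 \<Rightarrow> 'a" and x
  assume "\<And>y. y < x \<Longrightarrow> f y = g y"
  then have "f ` {..<x} = g ` {..<x}" by (intro image_cong) auto
  then show "Q (f ` {..<x}) r = Q (g ` {..<x}) r" by simp
next
  fix x :: omega1 and f :: "omega1 \<Rightarrow> 'a"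
  have "countable {..<x}" using countable_below_omega1[of x] by (simp add: lessThan_def)
  then show "\<exists>r. Q (f ` {..<x}) r" using assms by blast
qed

text \<open>Induction on \<open>c\<close>: if a maximal free set \<open>M\<close> is countable, uncountably many \<open>N \<xi>\<close>
  share a point of \<open>M\<close>, and discarding that point lowers the bound \<open>c\<close>.\<close>

lemma free_set_bounded:
  fixes N :: "omega1 \<Rightarrow> omega1 set"
  assumes "uncountable U" "\<And>\<xi>. \<xi> \<in> U \<Longrightarrow> finite (N \<xi> \<inter> U) \<and> card (N \<xi> \<inter> U) \<le> c"
    and below: "\<And>\<xi>. N \<xi> \<subseteq> {..<\<xi>}"
  shows "\<exists>W\<subseteq>U. uncountable W \<and> (\<forall>\<xi>\<in>W. N \<xi> \<inter> W = {})"
  using assms(1,2)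
proof (induction c arbitrary: U)
  case 0
  then have "\<forall>\<xi>\<in>U. N \<xi> \<inter> U = {}" by (metis card_0_eq le_zero_eq)
  with 0(1) show ?case by (intro exI[of _ U]) simp
next
  case (Suc c)
  let ?free = "{W. W \<subseteq> U \<and> (\<forall>\<xi>\<in>W. N \<xi> \<inter> W = {})}"
  have "\<exists>M\<in>?free. \<forall>W\<in>?free. M \<subseteq> W \<longrightarrow> W = M"
  proof (rule subset_Zorn')
    fix \<C> assume C: "subset.chain ?free \<C>"
    show "\<Union>\<C> \<in> ?free"
    proof (intro CollectI conjI ballI)
      show "\<Union>\<C> \<subseteq> U" using C by (auto simp: subset_chain_def)
      fix \<xi> assume "\<xi> \<in> \<Union>\<C>"
      then obtain A where A: "A \<in> \<C>" "\<xi> \<in> A" by blast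
      have free: "N \<xi> \<inter> B = {}" if "B \<in> \<C>" "\<xi> \<in> B" for B
        using C that unfolding subset_chain_def by blast
      have "N \<xi> \<inter> B = {}" if "B \<in> \<C>" for B
      proof -
        have "A \<subseteq> B \<or> B \<subseteq> A" using C A(1) that unfolding subset_chain_def by blast
        then show ?thesis using free[OF that] free[OF A] A(2) by blast
      qed
      then show "N \<xi> \<inter> \<Union>\<C> = {}" by blast
    qed
  qed
  then obtain M where M0: "M \<in> ?free" and max0: "\<forall>W\<in>?free. M \<subseteq> W \<longrightarrow> W = M" ..
  have M: "M \<subseteq> U" "\<And>\<xi>. \<xi> \<in> M \<Longrightarrow> N \<xi> \<inter> M = {}" using M0 by simp_all
  have max: "W = M" if "W \<subseteq> U" "\<forall>\<xi>\<in>W. N \<xi> \<inter> W = {}" "M \<subseteq> W" for W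
    using max0 that by simp
  show ?case
  proof (cases "countable M")
    case True
    then obtain b where b: "\<forall>x\<in>M. x < b" using countable_strict_bound_omega1 by blast
    \<comment> \<open>Maximality of \<open>M\<close>: each \<open>N x\<close> lies below
      \<open>x\<close>, so no \<open>N x\<close> with \<open>x\<close> in \<open>M\<close> contains
      a point above \<open>M\<close>. If \<open>N \<xi>\<close> also missed \<open>M\<close>, then
      \<xi> could be added.\<close>
    have hit: "N \<xi> \<inter> M \<noteq> {}" if "\<xi> \<in> U" "b \<le> \<xi>" for \<xi>
    proof
      assume "N \<xi> \<inter> M = {}"
      moreover have "\<xi> \<notin> N x" if "x \<in> insert \<xi> M" for x
        using below[of x] b that \<open>b \<le> \<xi>\<close> by fastforce
      ultimately have "insert \<xi> M = M"
        using M \<open>\<xi> \<in> U\<close> by (intro max) auto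
      then show False using b \<open>b \<le> \<xi>\<close> by (metis insertI1 leD)
    qed
    have "\<exists>w\<in>M. uncountable {\<xi>\<in>U. b \<le> \<xi> \<and> w \<in> N \<xi>}"
    proof (rule ccontr)
      assume "\<not> ?thesis"
      then have "countable (\<Union>w\<in>M. {\<xi>\<in>U. b \<le> \<xi> \<and> w \<in> N \<xi>})"
        using True by (intro countable_UN) auto
      then have "countable ((\<Union>w\<in>M. {\<xi>\<in>U. b \<le> \<xi> \<and> w \<in> N \<xi>}) \<union> {..b})"
        using countable_atMost_omega1 by blast
      moreover have "U \<subseteq> (\<Union>w\<in>M. {\<xi>\<in>U. b \<le> \<xi> \<and> w \<in> N \<xi>}) \<union> {..b}"
        using hit by fastforce
      ultimately show False using Suc.prems(1) countable_subset by blast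
    qed
    then obtain w where w: "w \<in> M" "uncountable {\<xi>\<in>U. b \<le> \<xi> \<and> w \<in> N \<xi>}" by blast
    let ?V = "{\<xi>\<in>U. b \<le> \<xi> \<and> w \<in> N \<xi>}"
    have "\<exists>W\<subseteq>?V. uncountable W \<and> (\<forall>\<xi>\<in>W. N \<xi> \<inter> W = {})"
    proof (rule Suc.IH[OF w(2)])
      fix \<xi> assume \<xi>: "\<xi> \<in> ?V"
      \<comment> \<open>All of \<open>M\<close> lies below \<open>b\<close>, while \<open>?V\<close>
        starts at \<open>b\<close>; so \<open>w\<close> disappears from every trace when
        \<open>U\<close> shrinks to \<open>?V\<close>.\<close>
      have "w \<in> U" "w \<notin> ?V" using w M b by auto
      then have "N \<xi> \<inter> ?V \<subset> N \<xi> \<inter> U" using \<xi> by auto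
      moreover have "finite (N \<xi> \<inter> U)" "card (N \<xi> \<inter> U) \<le> Suc c" using Suc.prems(2) \<xi> by auto
      ultimately show "finite (N \<xi> \<inter> ?V) \<and> card (N \<xi> \<inter> ?V) \<le> c"
        using psubset_card_mono[of "N \<xi> \<inter> U" "N \<xi> \<inter> ?V"]
        by (meson finite_subset less_Suc_eq_le order_less_le_trans psubset_imp_subset)
    qed
    then obtain W where "W \<subseteq> ?V" "uncountable W" "\<forall>\<xi>\<in>W. N \<xi> \<inter> W = {}"
      by (elim exE conjE)
    moreover from this have "W \<subseteq> U" by auto
    ultimately show ?thesis by (intro exI[of _ W]) simp
  next
    case False
    then show ?thesis using M by (intro exI[of _ M]) simp
  qed
qed

text \<open>By pigeonhole the cardinality of \<open>N \<xi>\<close> is constant on an uncountable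
  set, where the bounded case applies.\<close>

lemma free_set:
  fixes N :: "omega1 \<Rightarrow> omega1 set"
  assumes "uncountable U" "\<And>\<xi>. finite (N \<xi>)" "\<And>\<xi>. N \<xi> \<subseteq> {..<\<xi>}"
  shows "\<exists>W\<subseteq>U. uncountable W \<and> (\<forall>\<xi>\<in>W. N \<xi> \<inter> W = {})"
proof -
  obtain c where c: "uncountable {\<xi>\<in>U. card (N \<xi>) = c}"
    using uncountable_fiber[OF assms(1), of "\<lambda>\<xi>. card (N \<xi>)"] by blast
  have "\<exists>W\<subseteq>{\<xi>\<in>U. card (N \<xi>) = c}. uncountable W \<and> (\<forall>\<xi>\<in>W. N \<xi> \<inter> W = {})"
    by (rule free_set_bounded[OF c _ assms(3), where c = c])
      (use assms(2) in \<open>auto intro!: card_mono\<close>)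
  then obtain W where "W \<subseteq> {\<xi>\<in>U. card (N \<xi>) = c}" "uncountable W" "\<forall>\<xi>\<in>W. N \<xi> \<inter> W = {}"
    by (elim exE conjE)
  moreover from this have "W \<subseteq> U" by auto
  ultimately show ?thesis by (intro exI[of _ W]) simp
qed

section \<open>Transfer of the dichotomy\<close>

text \<open>Finite subsets of \<open>Y\<close> belong to \<open>I\<close> by hypothesis, so the
  first case can speak of all countable subsets.\<close>

lemma P_ideal_dichotomyE [consumes 4]:
  assumes "P_ideal_dichotomy_on X" "P_ideal_on X I"
    and "{A. A \<subseteq> X \<and> finite A} \<subseteq> I" "I \<subseteq> {A. countable A}"
  obtains
    (inside) Y f where "Y \<subseteq> X" "bij_betw f (UNIV :: omega1 set) Y"
      "\<And>A. A \<subseteq> Y \<Longrightarrow> countable A \<Longrightarrow> A \<in> I"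
  | (orthogonal) \<C> where "countable \<C>" "\<C> \<subseteq> orth X I" "\<Union>\<C> = X"
proof -
  have "I \<subseteq> Pow X" using assms(2) by (simp add: P_ideal_on_def ideal_on_def)
  then have "I \<subseteq> {A. A \<subseteq> X \<and> countable A}"
    using assms(4) by auto
  then have "(\<exists>Y\<subseteq>X. (\<exists>f. bij_betw f (UNIV :: omega1 set) Y) \<and>
      {A. A \<subseteq> Y \<and> countable A \<and> infinite A} \<subseteq> I) \<or>
    (\<exists>\<C>. countable \<C> \<and> \<C> \<subseteq> orth X I \<and> \<Union>\<C> = X)"
    using assms(1)[unfolded P_ideal_dichotomy_on_def, THEN spec, of I] assms(2,3) by simp
  then show thesis
  proof (elim disjE exE conjE)
    fix Y f
    assume *: "Y \<subseteq> X" "bij_betw f (UNIV :: omega1 set) Y"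
      "{A. A \<subseteq> Y \<and> countable A \<and> infinite A} \<subseteq> I"
    show thesis
    proof (rule inside[OF *(1,2)])
      fix A assume A: "A \<subseteq> Y" "countable A"
      show "A \<in> I"
      proof (cases "finite A")
        case True
        then show ?thesis using subset_trans[OF A(1) *(1)] assms(3) by auto
      next
        case False
        then show ?thesis using A *(3) by auto
      qed
    qed
  qed (rule orthogonal)
qed

text \<open>Pushing an ideal forward along \<open>h\<close> preserves the hypotheses of the
  dichotomy, and both alternatives pull back by injectivity.\<close>

lemma P_ideal_dichotomy_inj:
  assumes h: "inj_on h X" and pid: "P_ideal_dichotomy_on (h ` X)"
  shows "P_ideal_dichotomy_on X"
  unfolding P_ideal_dichotomy_on_def
proof (intro allI impI)
  fix I assume I: "P_ideal_on X I \<and> {A. A \<subseteq> X \<and> finite A} \<subseteq> I \<and> I \<subseteq> {A. A \<subseteq> X \<and> countable A}"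
  let ?J = "(`) h ` I"
  have IX: "A \<subseteq> X" if "A \<in> I" for A using I that by blast
  have ideal: "ideal_on X I" using I by (simp add: P_ideal_on_def)
  have P: "\<exists>B\<in>I. \<forall>A\<in>\<A>. finite (A - B)" if "countable \<A>" "\<A> \<subseteq> I" for \<A>
    using I that by (simp add: P_ideal_on_def)
  have sub: "\<exists>A'\<in>I. A' \<subseteq> A \<and> B = h ` A'" if "A \<in> I" "B \<subseteq> h ` A" for A B
    using that ideal unfolding ideal_on_def by (metis subset_imageE)
  have "ideal_on (h ` X) ?J"
    unfolding ideal_on_def
  proof (intro conjI ballI allI impI)
    show "?J \<subseteq> Pow (h ` X)" using IX by blast
    show "{} \<in> ?J" using ideal by (auto simp: ideal_on_def)
    show "B \<in> ?J" if "A \<in> ?J" "B \<subseteq> A" for A B using that sub by blast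
    show "A \<union> B \<in> ?J" if "A \<in> ?J" "B \<in> ?J" for A B
      using that ideal unfolding ideal_on_def by (auto simp: image_Un[symmetric])
  qed
  moreover have "\<exists>B\<in>?J. \<forall>A\<in>\<A>. finite (A - B)" if "countable \<A> \<and> \<A> \<subseteq> ?J" for \<A>
  proof -
    have "\<exists>\<B>. countable \<B> \<and> \<B> \<subseteq> I \<and> \<A> = (`) h ` \<B>"
      using that by (simp only: countable_subset_image)
    then obtain \<B> where B: "countable \<B>" "\<B> \<subseteq> I" "\<A> = (`) h ` \<B>" by (elim exE conjE)
    then obtain B where "B \<in> I" "\<forall>A\<in>\<B>. finite (A - B)"
      using P[OF B(1,2)] by (elim bexE)
    moreover have "h ` A - h ` B \<subseteq> h ` (A - B)" for A by blast
    ultimately show ?thesis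
      unfolding B(3) by (metis (no_types, lifting) finite_imageI finite_subset image_iff)
  qed
  ultimately have J: "P_ideal_on (h ` X) ?J" by (simp add: P_ideal_on_def)
  have J_fin: "{A. A \<subseteq> h ` X \<and> finite A} \<subseteq> ?J"
  proof
    fix A assume "A \<in> {A. A \<subseteq> h ` X \<and> finite A}"
    then have A: "A \<subseteq> h ` X" "finite A" by auto
    obtain B where "B \<subseteq> X" "finite B" "A = h ` B" using finite_subset_image[OF A(2,1)] by auto
    then show "A \<in> ?J" using I by blast
  qed
  have J_count: "?J \<subseteq> {A. countable A}" using I by auto
  show "(\<exists>Y\<subseteq>X. (\<exists>f. bij_betw f (UNIV :: omega1 set) Y) \<and>
      {A. A \<subseteq> Y \<and> countable A \<and> infinite A} \<subseteq> I) \<or>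
    (\<exists>\<C>. countable \<C> \<and> \<C> \<subseteq> orth X I \<and> \<Union>\<C> = X)"
    using pid J J_fin J_count
  proof (cases rule: P_ideal_dichotomyE)
    case (inside Y f)
    obtain Z where Z: "Z \<subseteq> X" "Y = h ` Z" using inside(1) by (meson subset_imageE)
    have "bij_betw h Z Y" using h Z by (simp add: bij_betw_def inj_on_subset)
    then have "bij_betw (inv_into Z h \<circ> f) UNIV Z"
      using inside(2) bij_betw_inv_into bij_betw_trans by blast
    moreover have "A \<in> I" if "A \<subseteq> Z" "countable A" "infinite A" for A
    proof -
      have "h ` A \<in> ?J" using inside(3)[of "h ` A"] that Z by auto
      then obtain B where "B \<in> I" "h ` A = h ` B" by blast
      then show ?thesis
        using h IX that(1) Z(1) by (metis inj_on_image_eq_iff subset_trans)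
    qed
    ultimately show ?thesis using Z by blast
  next
    case (orthogonal \<C>)
    define \<D> where "\<D> = (\<lambda>C. {x\<in>X. h x \<in> C}) ` \<C>"
    have "Z \<in> orth X I" if "Z \<in> \<D>" for Z
    proof -
      obtain C where C: "C \<in> \<C>" "Z = {x\<in>X. h x \<in> C}" using \<open>Z \<in> \<D>\<close> by (auto simp: \<D>_def)
      have "finite (Z \<inter> B)" if "B \<in> I" for B
      proof -
        have "finite (C \<inter> h ` B)" using C orthogonal(2) that by (auto simp: orth_def)
        moreover have "h ` (Z \<inter> B) \<subseteq> C \<inter> h ` B" using C by auto
        moreover have "inj_on h (Z \<inter> B)" using h C by (auto simp: inj_on_def)
        ultimately show ?thesis by (meson finite_image_iff finite_subset)
      qed
      then show ?thesis using C by (auto simp: orth_def)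
    qed
    moreover have "\<Union>\<D> = X" using orthogonal(3) by (auto simp: \<D>_def)
    moreover have "countable \<D>" using orthogonal(1) by (simp add: \<D>_def)
    ultimately show ?thesis by blast
  qed
qed

section \<open>Construction schemes\<close>

lemma initial_segment_Int_memI:
  assumes "initial_segment (A \<inter> B) A" "x \<in> A" "x \<in> B" "y \<in> A" "y \<le> x"
  shows "y \<in> B"
  using assms unfolding initial_segment_def by (cases "y = x") auto

locale scheme =
  fixes m n r :: "nat \<Rightarrow> nat" and \<F> :: "omega1 set set"
  assumes type: "scheme_type m n r" and scheme: "construction_scheme m n r \<F>"
begin

abbreviation lev where "lev \<equiv> level m \<F>"
abbreviation dec where "dec \<equiv> decomposition m n r \<F>"
abbreviation rh where "rh \<equiv> rho m \<F>"
abbreviation nrm where "nrm \<equiv> norm_at m \<F>"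
abbreviation xi where "xi \<equiv> Xi m n r \<F>"

section \<open>Coherence between sets of different levels\<close>

lemma r_less: "r (Suc k) < m k" and n_ge: "2 \<le> n (Suc k)"
  and m_Suc: "m (Suc k) = r (Suc k) + (m k - r (Suc k)) * n (Suc k)"
  using type unfolding scheme_type_def by auto

text \<open>As \<open>n (Suc k)\<close> is at least 2, the increment of \<open>m\<close> is at least
  \<open>m k - r (Suc k)\<close>, which is positive.\<close>

lemma strict_mono_m: "strict_mono m"
  unfolding strict_mono_Suc_iff
proof
  fix k
  have "(m k - r (Suc k)) * 2 \<le> (m k - r (Suc k)) * n (Suc k)"
    using n_ge by (rule mult_le_mono2)
  then show "m k < m (Suc k)"
    using r_less[of k] m_Suc[of k] by linarith
qed

lemma levD:
  assumes "F \<in> lev k"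
  shows "finite F" "F \<noteq> {}" "card F = m k" "F \<in> \<F>"
  using assms scheme unfolding level_def construction_scheme_def by auto

lemma cofinal: "finite A \<Longrightarrow> \<exists>k. \<exists>F\<in>lev k. A \<subseteq> F"
  using scheme unfolding construction_scheme_def level_def by (metis (mono_tags, lifting) mem_Collect_eq)

lemma ex_dec: "F \<in> lev (Suc k) \<Longrightarrow> \<exists>E R. dec k F E R"
  using scheme unfolding construction_scheme_def by blast

text \<open>Induction on \<open>l\<close>: \<open>G\<close> is a union of pieces of the level below,
  and a union of initial segments of \<open>E\<close> is again one.\<close>

lemma lev_initial:
  assumes "E \<in> lev k" "G \<in> lev l" "k \<le> l"
  shows "initial_segment (E \<inter> G) E"
  using assms(3,2)
proof (induction l arbitrary: G rule: dec_induct)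
  case base
  then show ?case
    using scheme assms(1) unfolding construction_scheme_def by blast
next
  case (step l)
  obtain D R where D: "dec l G D R" using ex_dec[OF step.prems] by blast
  then have G: "G = (\<Union>i<n (Suc l). D i)" and "\<And>i. i < n (Suc l) \<Longrightarrow> D i \<in> lev l"
    unfolding decomposition_def by auto
  then have "\<And>i. i < n (Suc l) \<Longrightarrow> initial_segment (E \<inter> D i) E"
    using step.IH by blast
  then show ?case
    unfolding G initial_segment_def by blast
qed

lemma lev_closed_below:
  assumes "E \<in> lev k" "G \<in> lev l" "k \<le> l" "x \<in> E" "x \<in> G" "y \<in> E" "y \<le> x"
  shows "y \<in> G"
  using initial_segment_Int_memI[OF lev_initial[OF assms(1-3)]] assms(4-) by blast

text \<open>The piece containing the maximum of \<open>E\<close> meets \<open>E\<close> in an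
  initial segment, hence contains all of \<open>E\<close>.\<close>

lemma subset_piece:
  assumes "E \<in> lev k" "dec l G D R" "k \<le> l" "E \<subseteq> G"
  shows "\<exists>i<n (Suc l). E \<subseteq> D i"
proof -
  have "Max E \<in> G" using levD(1,2)[OF assms(1)] assms(4) by (meson Max_in subsetD)
  then obtain i where i: "i < n (Suc l)" "Max E \<in> D i" "D i \<in> lev l"
    using assms(2) unfolding decomposition_def by auto
  have "E \<subseteq> D i"
    using lev_closed_below[OF assms(1) i(3) assms(3) _ i(2)] levD(1,2)[OF assms(1)]
    by (meson Max_ge Max_in subsetI)
  with i(1) show ?thesis by blast
qed

text \<open>Adding \<open>m l\<close> points to \<open>E\<close> before applying cofinality forces a
  superset of level at least \<open>l\<close>. From there one descends to level \<open>l\<close>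
  through the pieces that contain \<open>E\<close>.\<close>

lemma ex_lev_superset:
  assumes "E \<in> lev k" "k \<le> l"
  shows "\<exists>G\<in>lev l. E \<subseteq> G"
proof -
  have down: "\<exists>G\<in>lev l. E \<subseteq> G" if "l \<le> j" "H \<in> lev j" "E \<subseteq> H" for j H
    using that
  proof (induction j arbitrary: H rule: dec_induct)
    case base
    then show ?case by blast
  next
    case (step j)
    obtain D R where D: "dec j H D R" using ex_dec[OF step.prems(1)] by blast
    with subset_piece[OF assms(1) D _ step.prems(2)] step.hyps assms(2) obtain i where
      "i < n (Suc j)" "E \<subseteq> D i" by auto
    with D step.IH show ?case unfolding decomposition_def by blast
  qed
  have "infinite (UNIV :: omega1 set)"
    using uncountable_omega1 countable_finite by blast
  then obtain A :: "omega1 set" where A: "finite A" "card A = m l"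
    using infinite_arbitrarily_large by blast
  then obtain j H where H: "H \<in> lev j" "A \<union> E \<subseteq> H"
    using cofinal[of "A \<union> E"] levD(1)[OF assms(1)] by blast
  then have "m l \<le> m j"
    using A levD[OF H(1)] by (metis card_mono le_supE)
  then have "l \<le> j"
    using strict_mono_m by (simp add: strict_mono_less_eq)
  with down H show ?thesis by blast
qed

section \<open>The functions \<open>rh\<close> and \<open>nrm\<close>\<close>

lemma rho_le_iff: "rh \<alpha> \<beta> \<le> k \<longleftrightarrow> (\<exists>F\<in>lev k. \<alpha> \<in> F \<and> \<beta> \<in> F)"
proof
  let ?P = "\<lambda>k. \<exists>F\<in>lev k. {\<alpha>, \<beta>} \<subseteq> F"
  have "\<exists>k. ?P k" using cofinal[of "{\<alpha>, \<beta>}"] by blast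
  then have "?P (rh \<alpha> \<beta>)" unfolding rho_def by (rule LeastI_ex)
  then obtain F where F: "F \<in> lev (rh \<alpha> \<beta>)" "{\<alpha>, \<beta>} \<subseteq> F" by blast
  assume "rh \<alpha> \<beta> \<le> k"
  from ex_lev_superset[OF F(1) this] F(2) show "\<exists>F\<in>lev k. \<alpha> \<in> F \<and> \<beta> \<in> F" by blast
next
  assume "\<exists>F\<in>lev k. \<alpha> \<in> F \<and> \<beta> \<in> F"
  then show "rh \<alpha> \<beta> \<le> k" unfolding rho_def by (intro Least_le) auto
qed

text \<open>Descending through pieces gives a set of level 0 containing \<alpha>;
  \<open>rho_le_iff\<close> then carries \<alpha> up to every level.\<close>

lemma ex_lev_containing: "\<exists>F\<in>lev k. \<alpha> \<in> F"
proof -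
  obtain F j where F: "F \<in> lev j" "\<alpha> \<in> F" using cofinal[of "{\<alpha>}"] by blast
  have "rh \<alpha> \<alpha> \<le> 0"
  proof -
    obtain G where G: "G \<in> lev j" "\<alpha> \<in> G" using F by blast
    have "\<exists>H\<in>lev 0. \<alpha> \<in> H"
      using G
    proof (induction j arbitrary: G)
      case (Suc j)
      then obtain D R where "dec j G D R" using ex_dec by blast
      with Suc show ?case unfolding decomposition_def by blast
    qed blast
    then show ?thesis unfolding rho_le_iff by blast
  qed
  then have "rh \<alpha> \<alpha> \<le> k" by simp
  then show ?thesis by (auto simp: rho_le_iff)
qed

text \<open>By coherence, all sets of level \<open>k\<close> containing \<alpha> agree below
  \<alpha>; the norm is thus the position of \<alpha> in any of them.\<close>

lemma norm_at_eq:
  assumes "F \<in> lev k" "\<alpha> \<in> F"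
  shows "nrm \<alpha> k = card (F \<inter> {..<\<alpha>})"
proof -
  have "{\<xi>. \<xi> < \<alpha> \<and> rh \<alpha> \<xi> \<le> k} = F \<inter> {..<\<alpha>}"
  proof (intro equalityI subsetI)
    fix \<xi> assume "\<xi> \<in> {\<xi>. \<xi> < \<alpha> \<and> rh \<alpha> \<xi> \<le> k}"
    then obtain G where "G \<in> lev k" "\<alpha> \<in> G" "\<xi> \<in> G" "\<xi> < \<alpha>" unfolding rho_le_iff by blast
    then show "\<xi> \<in> F \<inter> {..<\<alpha>}"
      using lev_closed_below[OF _ assms(1) order_refl _ assms(2)] by simp
  next
    fix \<xi> assume "\<xi> \<in> F \<inter> {..<\<alpha>}"
    then show "\<xi> \<in> {\<xi>. \<xi> < \<alpha> \<and> rh \<alpha> \<xi> \<le> k}" using assms unfolding rho_le_iff by blast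
  qed
  then show ?thesis unfolding norm_at_def by simp
qed

lemma norm_at_less:
  assumes "rh \<alpha> \<beta> \<le> k" "\<alpha> < \<beta>"
  shows "nrm \<alpha> k < nrm \<beta> k"
proof -
  obtain F where F: "F \<in> lev k" "\<alpha> \<in> F" "\<beta> \<in> F" using assms(1) by (auto simp: rho_le_iff)
  have "F \<inter> {..<\<alpha>} \<subset> F \<inter> {..<\<beta>}" using F assms(2) by auto
  then show ?thesis
    using F levD(1)[OF F(1)] by (simp add: norm_at_eq psubset_card_mono)
qed

section \<open>Block numbers and captured pairs\<close>

lemma pieceD:
  assumes "dec k F E R" "i < n (Suc k)"
  shows "E i \<in> lev k" "finite (E i)" "E i \<subseteq> F" "R \<subseteq> E i" "finite R" "card R = r (Suc k)"
    "card (E i - R) = m k - r (Suc k)"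
proof -
  show E: "E i \<in> lev k" "E i \<subseteq> F" and R: "R \<subseteq> E i" "card R = r (Suc k)"
    using assms unfolding decomposition_def rtt_system_def by auto
  show fin: "finite (E i)" using levD E by blast
  show "finite R" by (rule finite_subset[OF R(1) fin])
  with R show "card (E i - R) = m k - r (Suc k)"
    using levD[OF E(1)] by (simp add: card_Diff_subset)
qed

text \<open>The block number is a function of the position in \<open>F\<close>; hence the definite description
  in \<^const>\<open>Xi\<close> has a unique solution, and \<open>\<Xi>\<^sub>\<alpha>(k)\<close> is a function of \<open>\<parallel>\<alpha>\<parallel>\<^sub>k\<close>.\<close>

definition block :: "nat \<Rightarrow> nat \<Rightarrow> int" where
  "block k p = (if p < r (Suc k) then - 1 else int ((p - r (Suc k)) div (m k - r (Suc k))))"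

text \<open>The root lies below all tails, so the part of \<open>F\<close> below \<alpha> is a
  proper subset of \<open>R\<close>.\<close>

lemma block_root:
  assumes "F \<in> lev (Suc k)" "dec k F E R" "\<alpha> \<in> R"
  shows "block k (nrm \<alpha> (Suc k)) = - 1"
proof -
  have 0: "0 < n (Suc k)" using n_ge[of k] by simp
  have "x \<in> R" if x: "x \<in> F" "x < \<alpha>" for x
  proof (rule ccontr)
    assume "x \<notin> R"
    then obtain j where "j < n (Suc k)" "x \<in> E j - R"
      using x(1) assms(2) unfolding decomposition_def by auto
    moreover have "\<forall>j<n (Suc k). set_below R (E j - R)"
      using assms(2) unfolding decomposition_def rtt_system_def by simp
    ultimately show False using assms(3) x(2) unfolding set_below_def by (meson less_asym)
  qed
  then have "F \<inter> {..<\<alpha>} \<subset> R" using assms(3) by auto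
  then have "card (F \<inter> {..<\<alpha>}) < r (Suc k)"
    using psubset_card_mono[OF pieceD(5)[OF assms(2) 0]] pieceD(6)[OF assms(2) 0] by simp
  moreover have "\<alpha> \<in> F" using assms(3) pieceD[OF assms(2) 0] by blast
  ultimately show ?thesis using norm_at_eq[OF assms(1)] by (simp add: block_def)
qed

text \<open>Below \<alpha>, the set \<open>F\<close> consists of the root, \<open>i\<close> full
  tails of size \<open>?d\<close>, and \<open>?c\<close> points of the tail of \<alpha>. Since
  \<alpha> itself is in that tail, \<open>?c < ?d\<close>, so the division returns
  \<open>i\<close>.\<close>

lemma block_tail:
  assumes "F \<in> lev (Suc k)" "dec k F E R" "i < n (Suc k)" "\<alpha> \<in> E i - R"
  shows "block k (nrm \<alpha> (Suc k)) = int i"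
proof -
  let ?d = "m k - r (Suc k)" and ?c = "card ((E i - R) \<inter> {..<\<alpha>})"
  let ?U = "\<Union>j<i. E j - R"
  note [simp] = pieceD[OF assms(2,3)]
  have rtt: "rtt_system (n (Suc k)) E R" and F: "F = (\<Union>i<n (Suc k). E i)"
    using assms(2) unfolding decomposition_def by auto
  have ord: "x < y" if "x \<in> E j - R" "y \<in> E j' - R" "j < j'" "j' < n (Suc k)" for x y j j'
    using rtt that unfolding rtt_system_def set_below_def by blast
  have root: "x < \<alpha>" if "x \<in> R" for x
    using rtt that assms(3,4) unfolding rtt_system_def set_below_def by blast
  have eq: "F \<inter> {..<\<alpha>} = R \<union> (?U \<union> ((E i - R) \<inter> {..<\<alpha>}))"
  proof (intro equalityI subsetI)
    fix x assume x: "x \<in> F \<inter> {..<\<alpha>}"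
    then obtain j where j: "j < n (Suc k)" "x \<in> E j" using F by auto
    show "x \<in> R \<union> (?U \<union> ((E i - R) \<inter> {..<\<alpha>}))"
    proof (cases "x \<in> R")
      case False
      then have "\<not> i < j" using ord[of \<alpha> i x j] assms(4) j x by auto
      then show ?thesis using j x False by (cases "j = i") auto
    qed simp
  next
    fix x assume x: "x \<in> R \<union> (?U \<union> ((E i - R) \<inter> {..<\<alpha>}))"
    then consider "x \<in> R" | j where "j < i" "x \<in> E j - R" | "x \<in> E i" "x < \<alpha>" by auto
    then show "x \<in> F \<inter> {..<\<alpha>}"
    proof cases
      case 1
      then show ?thesis using root pieceD(3,4)[OF assms(2,3)] by blast
    next
      case 2
      then show ?thesis using ord[of x j \<alpha> i] assms(3,4) F by auto
    next
      case 3
      then show ?thesis using pieceD(3)[OF assms(2,3)] by blast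
    qed
  qed
  have fin: "finite (E j)" if "j < i" for j using pieceD(2)[OF assms(2)] that assms(3) by simp
  have dis: "(E j - R) \<inter> (E j' - R) = {}" if "j < j'" "j' < n (Suc k)" for j j'
    using ord[OF _ _ that] by fastforce
  have "card ?U = (\<Sum>j<i. card (E j - R))"
  proof (rule card_UN_disjoint)
    show "\<forall>j\<in>{..<i}. \<forall>j'\<in>{..<i}. j \<noteq> j' \<longrightarrow> (E j - R) \<inter> (E j' - R) = {}"
    proof (intro ballI impI)
      fix j j' assume "j \<in> {..<i}" "j' \<in> {..<i}" "j \<noteq> j'"
      then show "(E j - R) \<inter> (E j' - R) = {}"
        using dis[of j j'] dis[of j' j] assms(3) by (cases "j < j'") auto
    qed
  qed (use fin in auto)
  also have "\<dots> = (\<Sum>j<i. ?d)" using pieceD(7)[OF assms(2)] assms(3) by (intro sum.cong) auto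
  finally have U: "card ?U = i * ?d" by simp
  have "card (?U \<union> ((E i - R) \<inter> {..<\<alpha>})) = i * ?d + ?c"
  proof (subst card_Un_disjoint)
    show "?U \<inter> ((E i - R) \<inter> {..<\<alpha>}) = {}" using dis[OF _ assms(3)] by blast
  qed (use fin U in auto)
  then have "card (F \<inter> {..<\<alpha>}) = r (Suc k) + (i * ?d + ?c)"
    unfolding eq by (subst card_Un_disjoint) (use fin in auto)
  moreover have "\<alpha> \<in> F" using assms(3,4) F by auto
  ultimately have p: "nrm \<alpha> (Suc k) = r (Suc k) + (i * ?d + ?c)"
    using norm_at_eq[OF assms(1)] by simp
  have "?c < card (E i - R)" by (rule psubset_card_mono) (use assms(4) in auto)
  then have "?c < ?d" by simp
  then show ?thesis unfolding block_def p by simp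
qed

lemma Xi_eq_block: "xi \<alpha> (Suc k) = block k (nrm \<alpha> (Suc k))"
proof -
  obtain F where F: "F \<in> lev (Suc k)" "\<alpha> \<in> F" using ex_lev_containing by blast
  then obtain E R where D: "dec k F E R" using ex_dec by blast
  then obtain i where i: "i < n (Suc k)" "\<alpha> \<in> E i" using F unfolding decomposition_def by auto
  show ?thesis
    unfolding Xi.simps(2)
  proof (rule the_equality)
    show "\<exists>F E R. F \<in> lev (Suc k) \<and> \<alpha> \<in> F \<and> dec k F E R \<and>
      (\<alpha> \<in> R \<and> block k (nrm \<alpha> (Suc k)) = - 1 \<or>
       (\<exists>i<n (Suc k). \<alpha> \<in> E i - R \<and> block k (nrm \<alpha> (Suc k)) = int i))"
    proof (intro exI conjI)
      show "\<alpha> \<in> R \<and> block k (nrm \<alpha> (Suc k)) = - 1 \<or>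
        (\<exists>i<n (Suc k). \<alpha> \<in> E i - R \<and> block k (nrm \<alpha> (Suc k)) = int i)"
      proof (cases "\<alpha> \<in> R")
        case True
        then show ?thesis using block_root[OF F(1) D] by simp
      next
        case False
        then have "\<alpha> \<in> E i - R" using i by simp
        then show ?thesis using block_tail[OF F(1) D i(1)] i(1) by blast
      qed
    qed (fact F D)+
    fix x
    assume "\<exists>F E R. F \<in> lev (Suc k) \<and> \<alpha> \<in> F \<and> dec k F E R \<and>
      (\<alpha> \<in> R \<and> x = - 1 \<or> (\<exists>i<n (Suc k). \<alpha> \<in> E i - R \<and> x = int i))"
    then show "x = block k (nrm \<alpha> (Suc k))"
      using block_root block_tail by (elim exE conjE disjE) simp_all
  qed
qed

declare Xi.simps(2) [simp del]

lemma Xi_root: "F \<in> lev (Suc k) \<Longrightarrow> dec k F E R \<Longrightarrow> \<alpha> \<in> R \<Longrightarrow> xi \<alpha> (Suc k) = - 1"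
  by (simp only: block_root Xi_eq_block)

lemma Xi_tail:
  "F \<in> lev (Suc k) \<Longrightarrow> dec k F E R \<Longrightarrow> i < n (Suc k) \<Longrightarrow> \<alpha> \<in> E i - R \<Longrightarrow> xi \<alpha> (Suc k) = int i"
  by (simp only: block_tail Xi_eq_block)

text \<open>A set of level \<open>k\<close> containing both points extends to level
  \<open>Suc k\<close>, and by \<open>subset_piece\<close> it lies in a single piece there.\<close>

lemma ex_common_piece:
  assumes "rh \<alpha> \<beta> \<le> k"
  obtains F E R i where "F \<in> lev (Suc k)" "dec k F E R" "i < n (Suc k)" "\<alpha> \<in> E i" "\<beta> \<in> E i"
proof -
  obtain A where A: "A \<in> lev k" "\<alpha> \<in> A" "\<beta> \<in> A" using assms by (auto simp: rho_le_iff)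
  obtain F where F: "F \<in> lev (Suc k)" "A \<subseteq> F" using ex_lev_superset[OF A(1), of "Suc k"] by auto
  obtain E R where D: "dec k F E R" using ex_dec F by blast
  obtain i where "i < n (Suc k)" "A \<subseteq> E i" using subset_piece[OF A(1) D _ F(2)] by auto
  with that F D A show ?thesis by blast
qed

text \<open>In a common piece each point has the value -1 or the index of that piece, so two
  distinct nonnegative values cannot occur.\<close>

lemma Xi_neq_of_rho_le:
  assumes "rh \<alpha> \<beta> \<le> k"
  shows "\<not> (xi \<alpha> (Suc k) = 0 \<and> xi \<beta> (Suc k) = 1)"
proof -
  obtain F E R i where "F \<in> lev (Suc k)" "dec k F E R" "i < n (Suc k)" "\<alpha> \<in> E i" "\<beta> \<in> E i"
    using assms by (rule ex_common_piece)
  then show ?thesis using Xi_root[of F k E R] Xi_tail[of F k E R i]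
    by (metis Diff_iff zero_neq_one zero_neq_neg_one one_neq_neg_one)
qed

text \<open>In a common piece \<gamma> is in the tail, and the root lies below the tail; so \<beta>,
  being no smaller, is in the same tail.\<close>

lemma Xi_eq_1_mono:
  assumes "rh \<gamma> \<beta> \<le> k" "\<gamma> \<le> \<beta>" "xi \<gamma> (Suc k) = 1"
  shows "xi \<beta> (Suc k) = 1"
proof -
  obtain F E R i where D: "F \<in> lev (Suc k)" "dec k F E R" "i < n (Suc k)" "\<gamma> \<in> E i" "\<beta> \<in> E i"
    using assms(1) by (rule ex_common_piece)
  have "\<gamma> \<notin> R" using Xi_root[OF D(1,2)] assms(3) by fastforce
  moreover from this have "\<beta> \<notin> R"
    using D assms(2) unfolding decomposition_def rtt_system_def set_below_def
    by (meson Diff_iff leD)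
  ultimately show ?thesis using Xi_tail[OF D(1,2,3)] D(4,5) assms(3) by (metis Diff_iff)
qed

text \<open>Applies 2-capturing to the pairs \<open>{u \<xi>, v \<xi>}\<close>. They are pairwise
  disjoint, so the root is empty and the two positions are those of \<open>u\<close> and
  \<open>v\<close>.\<close>

lemma captured_pairs:
  fixes u v :: "omega1 \<Rightarrow> omega1"
  assumes cap: "two_capturing m n r \<F>" and U: "uncountable U"
    and uv: "\<And>\<xi>. u \<xi> < v \<xi>" and sep: "\<And>\<eta> \<xi>. \<eta> < \<xi> \<Longrightarrow> v \<eta> < u \<xi>"
  obtains \<eta> \<xi> k where "\<eta> \<in> U" "\<xi> \<in> U" "\<eta> < \<xi>" "K \<le> k"
    "\<And>w. w \<in> {u, v} \<Longrightarrow> xi (w \<eta>) (Suc k) = 0 \<and> xi (w \<xi>) (Suc k) = 1 \<and>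
      rh (w \<eta>) (w \<xi>) = Suc k \<and> (\<forall>j\<le>k. nrm (w \<eta>) j = nrm (w \<xi>) j)"
proof -
  let ?d = "\<lambda>\<xi>. {u \<xi>, v \<xi>}"
  have disj: "?d \<eta> \<inter> ?d \<xi> = {}" if "\<eta> \<noteq> \<xi>" for \<eta> \<xi>
  proof (cases "\<eta> < \<xi>")
    case True
    then show ?thesis using uv[of \<eta>] uv[of \<xi>] sep[of \<eta> \<xi>] by auto
  next
    case False
    then have "\<xi> < \<eta>" using that by simp
    then show ?thesis using uv[of \<eta>] uv[of \<xi>] sep[of \<xi> \<eta>] by auto
  qed
  have "inj_on ?d U" by (rule inj_onI) (use disj in blast)
  then have "uncountable (?d ` U)" using U countable_image_inj_on by blast
  moreover have "\<forall>D\<in>?d ` U. finite D" by auto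
  ultimately have inf: "infinite {l. \<exists>D. D 0 \<in> ?d ` U \<and> D 1 \<in> ?d ` U \<and> D 0 \<noteq> D 1 \<and>
      captured m n r \<F> 2 D l}" (is "infinite ?L")
    using cap unfolding two_capturing_def by blast
  \<comment> \<open>Infinitely many levels are available; one above \<open>K\<close> is also
    positive, hence of the form \<open>Suc k\<close>.\<close>
  then obtain l where l: "l \<in> ?L" "Suc K \<le> l" by (meson infinite_nat_iff_unbounded_le)
  then obtain k where k: "l = Suc k" "K \<le> k" by (cases l) auto
  obtain D where "D 0 \<in> ?d ` U" "D 1 \<in> ?d ` U" and neq: "D 0 \<noteq> D 1"
    and capt: "captured m n r \<F> 2 D l"
    using l(1) by (elim CollectE exE conjE) (rule that)
  then obtain \<eta> \<xi> where \<eta>: "\<eta> \<in> U" "D 0 = ?d \<eta>" and \<xi>: "\<xi> \<in> U" "D 1 = ?d \<xi>"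
    by blast
  obtain s R where s: "\<forall>i<2. finite (D i) \<and> card (D i) = s" and rtt: "rtt_system 2 D R"
    and Xi: "\<forall>i<2. \<forall>a\<in>{card R..<s}. xi (elt (D i) a) l = int i"
    and rho: "\<forall>j<2. \<forall>i<j. \<forall>a\<in>{card R..<s}. rh (elt (D i) a) (elt (D j) a) = l \<and>
      Delta m \<F> (elt (D i) a) (elt (D j) a) = l"
    using capt unfolding captured_def by (elim exE conjE) (rule that)
  have "\<eta> \<noteq> \<xi>" using neq \<eta> \<xi> by auto
  then have "D 0 \<inter> D 1 = {}" using disj \<eta> \<xi> by metis
  then have R: "R = {}" using rtt by (auto simp: rtt_system_def)
  \<comment> \<open>With empty root, capturing puts \<open>D 0\<close> entirely below
    \<open>D 1\<close>, which decides the order of the indices.\<close>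
  have "set_below (D 0) (D 1)" using rtt R by (auto simp: rtt_system_def)
  then have "v \<eta> < u \<xi>" using \<eta> \<xi> by (auto simp: set_below_def)
  then have less: "\<eta> < \<xi>"
    using sep[of \<xi> \<eta>] uv[of \<eta>] uv[of \<xi>] \<open>\<eta> \<noteq> \<xi>\<close> by (meson less_asym neqE order.strict_trans)
  have lists: "sorted_list_of_set (?d \<zeta>) = [u \<zeta>, v \<zeta>]" for \<zeta>
    using uv[of \<zeta>] by (intro sorted_list_of_set.idem_if_sorted_distinct[of "[u \<zeta>, v \<zeta>]", simplified list.set]) auto
  have "card (D 0) = 2" using \<eta>(2) uv[of \<eta>] by auto
  then have s2: "s = 2" using s by simp
  have el: "\<exists>a<2. elt (D 0) a = w \<eta> \<and> elt (D 1) a = w \<xi>" if "w \<in> {u, v}" for w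
  proof (cases "w = u")
    case True
    then show ?thesis using \<eta> \<xi> lists by (intro exI[of _ 0]) (simp add: elt_def)
  next
    case False
    then show ?thesis using \<eta> \<xi> lists that by (intro exI[of _ 1]) (simp add: elt_def)
  qed
  \<comment> \<open>Minimality in \<open>Delta\<close>: the norms first differ at
    \<open>Suc k\<close>.\<close>
  have norms: "nrm \<alpha> j = nrm \<beta> j" if "Delta m \<F> \<alpha> \<beta> = Suc k" "j \<le> k" for \<alpha> \<beta> j
    using that not_less_Least[of j "\<lambda>k. nrm \<alpha> k \<noteq> nrm \<beta> k"] unfolding Delta_def by auto
  have "xi (w \<eta>) (Suc k) = 0 \<and> xi (w \<xi>) (Suc k) = 1 \<and>
      rh (w \<eta>) (w \<xi>) = Suc k \<and> (\<forall>j\<le>k. nrm (w \<eta>) j = nrm (w \<xi>) j)" if w: "w \<in> {u, v}" for w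
  proof -
    obtain a where a: "a < 2" "elt (D 0) a = w \<eta>" "elt (D 1) a = w \<xi>" using el[OF w] by blast
    then have a': "a \<in> {card R..<s}" using R s2 by simp
    have "xi (elt (D 0) a) l = 0" "xi (elt (D 1) a) l = 1"
      using Xi[rule_format, of 0 a] Xi[rule_format, of 1 a] a' by simp_all
    moreover have "rh (elt (D 0) a) (elt (D 1) a) = l" "Delta m \<F> (elt (D 0) a) (elt (D 1) a) = l"
      using rho[rule_format, of 1 0 a] a' by simp_all
    ultimately show ?thesis using a norms k(1) by simp
  qed
  then show thesis using that \<eta> \<xi> less k by blast
qed

section \<open>The P-ideal of a construction scheme\<close>

definition clash :: "omega1 \<Rightarrow> omega1 \<Rightarrow> nat set" where
  "clash \<alpha> \<beta> = {k. xi \<alpha> (Suc k) = 0 \<and> xi \<beta> (Suc k) = 1 \<and> nrm \<alpha> k < nrm \<beta> k}"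

text \<open>From level \<open>rh \<alpha> \<beta>\<close> on, both points share a piece, which
  excludes the values 0 and 1 together. In particular every clash set is finite.\<close>

lemma clash_less_rho: "k \<in> clash \<alpha> \<beta> \<Longrightarrow> k < rh \<alpha> \<beta>"
  using Xi_neq_of_rho_le unfolding clash_def by (metis (mono_tags, lifting) mem_Collect_eq not_le)

text \<open>From level \<open>rh \<gamma> \<beta>\<close> on, the value 1 passes from \<gamma> to
  \<beta> and the norm can only grow. This threshold does not depend on \<alpha>.\<close>

lemma clash_mono:
  assumes "k \<in> clash \<alpha> \<gamma>" "rh \<gamma> \<beta> \<le> k" "\<gamma> \<le> \<beta>"
  shows "k \<in> clash \<alpha> \<beta>"
proof (cases "\<gamma> = \<beta>")
  case False
  then have "nrm \<gamma> k < nrm \<beta> k" using norm_at_less[OF assms(2)] assms(3) by simp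
  then show ?thesis using assms(1) Xi_eq_1_mono[OF assms(2,3)] unfolding clash_def by auto
qed (use assms(1) in simp)

definition unbounded_clash :: "omega1 set \<Rightarrow> omega1 \<Rightarrow> bool" where
  "unbounded_clash A \<beta> \<longleftrightarrow> (\<forall>N. finite {\<alpha>\<in>A. clash \<alpha> \<beta> \<subseteq> {..N}})"

text \<open>An element of \<open>clash \<alpha> \<gamma>\<close> beyond both \<open>N\<close> and
  \<open>rh \<gamma> \<beta>\<close> survives in \<open>clash \<alpha> \<beta>\<close>, where it
  exceeds \<open>N\<close>.\<close>

lemma unbounded_clash_mono:
  assumes "unbounded_clash A \<gamma>" "\<gamma> \<le> \<beta>" "B \<subseteq> A"
  shows "unbounded_clash B \<beta>"
  unfolding unbounded_clash_def
proof
  fix N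
  have "clash \<alpha> \<gamma> \<subseteq> {..max N (rh \<gamma> \<beta>)}" if "clash \<alpha> \<beta> \<subseteq> {..N}" for \<alpha>
    using that clash_mono[OF _ _ assms(2), of _ \<alpha>] by (force simp: le_max_iff_disj)
  then have "{\<alpha>\<in>B. clash \<alpha> \<beta> \<subseteq> {..N}} \<subseteq> {\<alpha>\<in>A. clash \<alpha> \<gamma> \<subseteq> {..max N (rh \<gamma> \<beta>)}}"
    using assms(3) by blast
  then show "finite {\<alpha>\<in>B. clash \<alpha> \<beta> \<subseteq> {..N}}"
    using assms(1) unfolding unbounded_clash_def by (meson finite_subset)
qed

definition clash_ideal :: "omega1 set set" where
  "clash_ideal = {A. countable A \<and> (\<exists>\<beta>. unbounded_clash A \<beta>)}"

text \<open>Countably many witnesses have a common upper bound \<gamma>, which serves for all sets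
  by monotonicity. A diagonal union then gives the pseudo-union.\<close>

lemma P_ideal_clash_ideal: "P_ideal_on UNIV clash_ideal"
  unfolding P_ideal_on_def
proof (intro conjI allI impI)
  show "ideal_on UNIV clash_ideal"
    unfolding ideal_on_def
  proof (intro conjI ballI allI impI)
    show "{} \<in> clash_ideal" by (simp add: clash_ideal_def unbounded_clash_def)
    show "B \<in> clash_ideal" if "A \<in> clash_ideal" "B \<subseteq> A" for A B
      using that(1) countable_subset[OF that(2)] unbounded_clash_mono[OF _ order_refl that(2)]
      by (auto simp: clash_ideal_def)
    fix A B assume "A \<in> clash_ideal" "B \<in> clash_ideal"
    then obtain \<beta> \<gamma> where *: "countable A" "countable B" "unbounded_clash A \<beta>" "unbounded_clash B \<gamma>"
      by (auto simp: clash_ideal_def)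
    then have "unbounded_clash A (max \<beta> \<gamma>)" "unbounded_clash B (max \<beta> \<gamma>)"
      by (auto intro: unbounded_clash_mono)
    moreover have "{\<alpha>\<in>A \<union> B. X \<alpha>} = {\<alpha>\<in>A. X \<alpha>} \<union> {\<alpha>\<in>B. X \<alpha>}" for X by blast
    ultimately have "unbounded_clash (A \<union> B) (max \<beta> \<gamma>)" by (simp add: unbounded_clash_def)
    then show "A \<union> B \<in> clash_ideal" using * by (auto simp: clash_ideal_def)
  qed simp
next
  fix \<A> assume A: "countable \<A> \<and> \<A> \<subseteq> clash_ideal"
  show "\<exists>B\<in>clash_ideal. \<forall>A\<in>\<A>. finite (A - B)"
  proof (cases "\<A> = {}")
    case True
    have "{} \<in> clash_ideal" by (simp add: clash_ideal_def unbounded_clash_def)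
    with True show ?thesis by blast
  next
    case False
    then obtain a :: "nat \<Rightarrow> omega1 set" where a: "range a = \<A>"
      using A by (metis uncountable_def)
    have "\<forall>i. \<exists>\<beta>. unbounded_clash (a i) \<beta>" using A a by (auto simp: clash_ideal_def)
    then obtain b where b: "\<And>i. unbounded_clash (a i) (b i)" by metis
    obtain \<gamma> where "\<forall>x\<in>range b. x < \<gamma>" using countable_strict_bound_omega1[of "range b"] by auto
    then have g: "unbounded_clash (a i) \<gamma>" for i
      using unbounded_clash_mono[OF b[of i] _ order_refl] by (simp add: less_imp_le)
    let ?bad = "\<lambda>N. {\<alpha>. clash \<alpha> \<gamma> \<subseteq> {..N}}"
    have fin: "finite (a i \<inter> ?bad N)" for i N
    proof -
      have "a i \<inter> ?bad N = {\<alpha>\<in>a i. clash \<alpha> \<gamma> \<subseteq> {..N}}" by auto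
      then show ?thesis using g[of i] by (simp add: unbounded_clash_def)
    qed
    \<comment> \<open>Removing from \<open>a i\<close> its finitely many points with clash bounded
      by \<open>i\<close> ensures that only sets \<open>a i\<close> with \<open>i < N\<close>
      contribute points with clash bounded by \<open>N\<close>.\<close>
    define B where "B = (\<Union>i. a i - ?bad i)"
    have "unbounded_clash B \<gamma>"
      unfolding unbounded_clash_def
    proof
      fix N
      have "{\<alpha>\<in>B. clash \<alpha> \<gamma> \<subseteq> {..N}} \<subseteq> (\<Union>i<N. a i \<inter> ?bad N)"
      proof
        fix \<alpha> assume "\<alpha> \<in> {\<alpha>\<in>B. clash \<alpha> \<gamma> \<subseteq> {..N}}"
        then obtain i where i: "\<alpha> \<in> a i" "\<not> clash \<alpha> \<gamma> \<subseteq> {..i}" "clash \<alpha> \<gamma> \<subseteq> {..N}"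
          by (auto simp: B_def)
        then have "\<not> N \<le> i" by (meson atMost_subset_iff order_trans)
        with i show "\<alpha> \<in> (\<Union>i<N. a i \<inter> ?bad N)" by auto
      qed
      then show "finite {\<alpha>\<in>B. clash \<alpha> \<gamma> \<subseteq> {..N}}"
        by (rule finite_subset) (use fin in blast)
    qed
    moreover have "countable B"
      unfolding B_def using A a by (auto simp: clash_ideal_def intro!: countable_UN countable_Diff)
    ultimately have "B \<in> clash_ideal" by (auto simp: clash_ideal_def)
    moreover have "finite (a i - B)" for i
      by (rule finite_subset[OF _ fin[of i i]]) (auto simp: B_def)
    ultimately show ?thesis using a by blast
  qed
qed

text \<open>In the recursion \<open>\<alpha>\<close> must be chosen after, hence above, \<open>\<gamma>\<close>: this is what makes the norm of
  \<open>\<alpha>\<close> the larger one.\<close>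

lemma no_uncountable_in_clash_ideal:
  assumes cap: "two_capturing m n r \<F>" and Y: "uncountable Y"
    and sub: "\<And>A. A \<subseteq> Y \<Longrightarrow> countable A \<Longrightarrow> A \<in> clash_ideal"
  shows False
proof -
  \<comment> \<open>A pair is (\<gamma>, \<alpha>), placed above all earlier pairs. The guard
    \<open>snd\<close> keeps \<open>Q\<close> satisfiable for every countable \<open>C\<close>,
    including those with second components outside \<open>Y\<close>.\<close>
  define Q where "Q C x \<longleftrightarrow> snd x \<in> Y \<and> fst x < snd x \<and> (\<forall>y\<in>C. snd y < fst x) \<and>
    (snd ` C \<subseteq> Y \<longrightarrow> unbounded_clash (snd ` C) (fst x))" for C :: "(omega1 \<times> omega1) set" and x
  have ex: "\<exists>x. Q C x" if C: "countable C" for C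
  proof -
    obtain \<beta> where \<beta>: "snd ` C \<subseteq> Y \<longrightarrow> unbounded_clash (snd ` C) \<beta>"
      using sub[of "snd ` C"] C by (auto simp: clash_ideal_def)
    have "countable (insert \<beta> (snd ` C))" using C by simp
    then obtain \<gamma> where \<gamma>: "\<forall>x\<in>insert \<beta> (snd ` C). x < \<gamma>"
      using countable_strict_bound_omega1 by blast
    obtain \<alpha> where "\<alpha> \<in> Y" "\<gamma> < \<alpha>" using uncountable_unbounded_omega1[OF Y] by blast
    with \<gamma> \<beta> have "Q C (\<gamma>, \<alpha>)"
      unfolding Q_def by (auto intro: unbounded_clash_mono)
    then show ?thesis by blast
  qed
  have "\<exists>f :: omega1 \<Rightarrow> omega1 \<times> omega1. \<forall>\<xi>. Q (f ` {..<\<xi>}) (f \<xi>)"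
    by (rule omega1_recursion) (rule ex)
  then obtain f :: "omega1 \<Rightarrow> omega1 \<times> omega1" where "\<forall>\<xi>. Q (f ` {..<\<xi>}) (f \<xi>)" ..
  then have f: "Q (f ` {..<\<xi>}) (f \<xi>)" for \<xi> ..
  define g a where "g \<xi> = fst (f \<xi>)" and "a \<xi> = snd (f \<xi>)" for \<xi>
  have ga: "g \<xi> < a \<xi>" and Ya: "a \<xi> \<in> Y" for \<xi>
    using f[of \<xi>] by (simp_all add: Q_def g_def a_def)
  have sep: "a \<eta> < g \<xi>" if "\<eta> < \<xi>" for \<eta> \<xi>
    using f[of \<xi>] that by (simp add: Q_def g_def a_def)
  have "unbounded_clash (a ` {..<\<xi>}) (g \<xi>)" for \<xi>
  proof -
    have "snd ` f ` {..<\<xi>} = a ` {..<\<xi>}" by (simp add: a_def image_image)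
    moreover have "a ` {..<\<xi>} \<subseteq> Y" using Ya by blast
    ultimately show ?thesis using f[of \<xi>] by (simp add: Q_def g_def)
  qed
  then have fin: "finite {\<alpha> \<in> a ` {..<\<xi>}. clash \<alpha> (g \<xi>) \<subseteq> {..N}}" for N \<xi>
    by (auto simp: unbounded_clash_def)
  obtain N where N: "uncountable {\<xi>\<in>UNIV. rh (g \<xi>) (a \<xi>) = N}"
    using uncountable_fiber[OF uncountable_omega1, of "\<lambda>\<xi>. rh (g \<xi>) (a \<xi>)"] by blast
  have "inj a"
    using sep ga by (intro linorder_injI) (metis less_irrefl order.strict_trans)
  \<comment> \<open>The earlier indices that spoil unboundedness at \<open>N\<close>. There are
    finitely many for each \<xi>, so a free set \<open>W\<close> avoids them.\<close>
  define bad where "bad \<xi> = {\<eta>. \<eta> < \<xi> \<and> clash (a \<eta>) (g \<xi>) \<subseteq> {..N}}" for \<xi>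
  have "finite (bad \<xi>)" for \<xi>
  proof (rule finite_imageD)
    show "finite (a ` bad \<xi>)"
      by (rule finite_subset[OF _ fin[of \<xi> N]]) (auto simp: bad_def)
    show "inj_on a (bad \<xi>)" using \<open>inj a\<close> by (rule inj_on_subset) simp
  qed
  moreover have "bad \<xi> \<subseteq> {..<\<xi>}" for \<xi> by (auto simp: bad_def)
  ultimately have "\<exists>W\<subseteq>{\<xi>\<in>UNIV. rh (g \<xi>) (a \<xi>) = N}. uncountable W \<and> (\<forall>\<xi>\<in>W. bad \<xi> \<inter> W = {})"
    by (rule free_set[OF N])
  then obtain W where W: "W \<subseteq> {\<xi>\<in>UNIV. rh (g \<xi>) (a \<xi>) = N}" "uncountable W"
    "\<forall>\<xi>\<in>W. bad \<xi> \<inter> W = {}" by (elim exE conjE)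
  obtain \<eta> \<xi> k where k: "\<eta> \<in> W" "\<xi> \<in> W" "\<eta> < \<xi>" "N \<le> k"
    and capt: "\<And>w. w \<in> {g, a} \<Longrightarrow> xi (w \<eta>) (Suc k) = 0 \<and> xi (w \<xi>) (Suc k) = 1 \<and>
      rh (w \<eta>) (w \<xi>) = Suc k \<and> (\<forall>j\<le>k. nrm (w \<eta>) j = nrm (w \<xi>) j)"
  proof (rule captured_pairs[where u = g and v = a and K = "N", OF cap W(2)])
    show "g \<xi> < a \<xi>" for \<xi> by (rule ga)
    show "a \<eta> < g \<xi>" if "\<eta> < \<xi>" for \<eta> \<xi> using that by (rule sep)
  qed (rule that)
  have rN: "rh (g \<xi>) (a \<xi>) = N" using W k by auto
  \<comment> \<open>A set of level \<open>Suc k\<close> containing \<open>a \<eta>\<close> and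
    \<open>a \<xi>\<close> also contains \<open>g \<xi>\<close>, by coherence with one containing
    \<open>g \<xi>\<close> and \<open>a \<xi>\<close>, since
    \<open>g \<xi> < a \<xi>\<close>.\<close>
  have "rh (g \<xi>) (a \<eta>) \<le> Suc k"
  proof -
    have "rh (g \<xi>) (a \<xi>) \<le> Suc k" "rh (a \<eta>) (a \<xi>) \<le> Suc k" using rN k capt[of a] by auto
    then show ?thesis
      unfolding rho_le_iff using lev_closed_below[OF _ _ order_refl] ga[of \<xi>]
      by (meson less_imp_le)
  qed
  then have rk: "rh (a \<eta>) (g \<xi>) \<le> Suc k" by (auto simp: rho_le_iff)
  \<comment> \<open>A clash at \<open>j\<close> forces \<open>j \<le> k\<close>, where
    \<open>a \<eta>\<close> and \<open>a \<xi>\<close> have equal norms, so \<open>a \<xi>\<close>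
    has smaller norm than \<open>g \<xi>\<close>. From level \<open>N\<close> on the opposite
    inequality holds.\<close>
  have "clash (a \<eta>) (g \<xi>) \<subseteq> {..N}"
  proof
    fix j assume j: "j \<in> clash (a \<eta>) (g \<xi>)"
    then have "j \<le> k" using clash_less_rho[OF j] rk by simp
    then have "nrm (a \<xi>) j < nrm (g \<xi>) j" using capt[of a] j by (auto simp: clash_def)
    then have "\<not> N \<le> j" using norm_at_less[OF _ ga, of \<xi> j] rN by auto
    then show "j \<in> {..N}" by simp
  qed
  then have "\<eta> \<in> bad \<xi>" using k(3) by (simp add: bad_def)
  then show False using W(3) k(1,2) by blast
qed

lemma orth_clash_ideal_countable:
  assumes cap: "two_capturing m n r \<F>" and Z: "Z \<in> orth UNIV clash_ideal"
  shows "countable Z"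
proof (rule ccontr)
  assume unc: "uncountable Z"
  \<comment> \<open>Without a common bound, points \<open>a N\<close> of \<open>Z\<close> with clash
    beyond \<open>N\<close> form a member of the ideal, whose intersection with \<open>Z\<close>
    must be finite.\<close>
  have "\<exists>N. \<forall>\<alpha>\<in>Z. \<alpha> < \<beta> \<longrightarrow> clash \<alpha> \<beta> \<subseteq> {..N}" for \<beta>
  proof (rule ccontr)
    assume "\<not> ?thesis"
    then have "\<forall>N. \<exists>\<alpha>. \<alpha> \<in> Z \<and> \<alpha> < \<beta> \<and> \<not> clash \<alpha> \<beta> \<subseteq> {..N}" by blast
    then obtain a where a: "\<And>N. a N \<in> Z" "\<And>N. a N < \<beta>" "\<And>N. \<not> clash (a N) \<beta> \<subseteq> {..N}" by metis
    have "unbounded_clash (range a) \<beta>"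
      unfolding unbounded_clash_def
    proof
      fix N
      have "{\<alpha>\<in>range a. clash \<alpha> \<beta> \<subseteq> {..N}} \<subseteq> a ` {..<N}"
      proof
        fix \<alpha> assume "\<alpha> \<in> {\<alpha>\<in>range a. clash \<alpha> \<beta> \<subseteq> {..N}}"
        then obtain i where i: "\<alpha> = a i" "clash (a i) \<beta> \<subseteq> {..N}" by auto
        then have "\<not> N \<le> i" using a(3)[of i] by (meson atMost_subset_iff order_trans)
        with i show "\<alpha> \<in> a ` {..<N}" by auto
      qed
      then show "finite {\<alpha>\<in>range a. clash \<alpha> \<beta> \<subseteq> {..N}}" by (rule finite_subset) simp
    qed
    then have "range a \<in> clash_ideal" by (auto simp: clash_ideal_def)
    then have "finite (Z \<inter> range a)" using Z by (auto simp: orth_def)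
    moreover have "Z \<inter> range a = range a" using a(1) by blast
    ultimately have fin: "finite (range a)" by simp
    \<comment> \<open>A finite range bounds all \<open>rh (a N) \<beta>\<close> by \<open>M\<close>,
      hence all clash sets too, contrary to the choice of \<open>a M\<close>.\<close>
    define M where "M = Max ((\<lambda>\<alpha>. rh \<alpha> \<beta>) ` range a)"
    have "rh (a M) \<beta> \<le> M" unfolding M_def using fin by (intro Max_ge) auto
    then have "clash (a M) \<beta> \<subseteq> {..M}" using clash_less_rho[of _ "a M" \<beta>] by force
    then show False using a(3) by blast
  qed
  then obtain b where b: "\<And>\<alpha> \<beta>. \<alpha> \<in> Z \<Longrightarrow> \<alpha> < \<beta> \<Longrightarrow> clash \<alpha> \<beta> \<subseteq> {..b \<beta>}" by metis
  obtain N where N: "uncountable {\<beta>\<in>UNIV. b \<beta> = N}"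
    using uncountable_fiber[OF uncountable_omega1, of b] by blast
  define Q where "Q C x \<longleftrightarrow> fst x \<in> Z \<and> b (snd x) = N \<and> fst x < snd x \<and> (\<forall>y\<in>C. snd y < fst x)"
    for C :: "(omega1 \<times> omega1) set" and x
  have ex: "\<exists>x. Q C x" if C: "countable C" for C
  proof -
    obtain \<delta> where \<delta>: "\<forall>x\<in>snd ` C. x < \<delta>"
      using countable_strict_bound_omega1[OF countable_image[OF C]] ..
    obtain \<alpha> where \<alpha>: "\<alpha> \<in> Z" "\<delta> < \<alpha>" using uncountable_unbounded_omega1[OF unc] by blast
    obtain \<beta> where "b \<beta> = N" "\<alpha> < \<beta>" using uncountable_unbounded_omega1[OF N, of \<alpha>] by auto
    with \<alpha> \<delta> have "Q C (\<alpha>, \<beta>)" by (auto simp: Q_def)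
    then show ?thesis by blast
  qed
  have "\<exists>f :: omega1 \<Rightarrow> omega1 \<times> omega1. \<forall>\<xi>. Q (f ` {..<\<xi>}) (f \<xi>)"
    by (rule omega1_recursion) (rule ex)
  then obtain f :: "omega1 \<Rightarrow> omega1 \<times> omega1" where "\<forall>\<xi>. Q (f ` {..<\<xi>}) (f \<xi>)" ..
  then have f: "Q (f ` {..<\<xi>}) (f \<xi>)" for \<xi> ..
  define u v where "u \<xi> = fst (f \<xi>)" and "v \<xi> = snd (f \<xi>)" for \<xi>
  have uv: "u \<xi> < v \<xi>" and Zu: "u \<xi> \<in> Z" and bv: "b (v \<xi>) = N" for \<xi>
    using f[of \<xi>] by (simp_all add: Q_def u_def v_def)
  have sep: "v \<eta> < u \<xi>" if "\<eta> < \<xi>" for \<eta> \<xi>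
    using f[of \<xi>] that by (simp add: Q_def u_def v_def)
  obtain K where K: "uncountable {\<xi>\<in>UNIV. rh (u \<xi>) (v \<xi>) = K}"
    using uncountable_fiber[OF uncountable_omega1, of "\<lambda>\<xi>. rh (u \<xi>) (v \<xi>)"] by blast
  let ?U = "{\<xi>\<in>UNIV. rh (u \<xi>) (v \<xi>) = K}"
  \<comment> \<open>The bound \<open>K\<close> makes \<open>u \<xi>\<close> and
    \<open>v \<xi>\<close> comparable in norm at \<open>k\<close>; \<open>Suc N\<close> puts
    \<open>k\<close> beyond the common clash bound.\<close>
  obtain \<eta> \<xi> k where k: "\<eta> \<in> ?U" "\<xi> \<in> ?U" "\<eta> < \<xi>" "max K (Suc N) \<le> k"
    and capt: "\<And>w. w \<in> {u, v} \<Longrightarrow> xi (w \<eta>) (Suc k) = 0 \<and> xi (w \<xi>) (Suc k) = 1 \<and>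
      rh (w \<eta>) (w \<xi>) = Suc k \<and> (\<forall>j\<le>k. nrm (w \<eta>) j = nrm (w \<xi>) j)"
  proof (rule captured_pairs[where u = u and v = v and K = "max K (Suc N)", OF cap K])
    show "u \<xi> < v \<xi>" for \<xi> by (rule uv)
    show "v \<eta> < u \<xi>" if "\<eta> < \<xi>" for \<eta> \<xi> using that by (rule sep)
  qed (rule that)
  \<comment> \<open>Capturing equates the norms of \<open>u \<eta>\<close> and
    \<open>u \<xi>\<close> at \<open>k\<close>, so this inequality makes \<open>k\<close> itself a
    clash of \<open>u \<eta>\<close> with \<open>v \<xi>\<close>.\<close>
  have "nrm (u \<xi>) k < nrm (v \<xi>) k" using norm_at_less[OF _ uv, of \<xi> k] k by simp
  then have "k \<in> clash (u \<eta>) (v \<xi>)" using capt[of u] capt[of v] by (simp add: clash_def)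
  moreover have "u \<eta> < v \<xi>" using uv sep[OF k(3)] by (meson order.strict_trans)
  ultimately show False using b[OF Zu, of \<eta> "v \<xi>"] bv k(4) by auto
qed

lemma not_two_capturing:
  assumes "P_ideal_dichotomy_on (UNIV :: omega1 set)"
  shows "\<not> two_capturing m n r \<F>"
proof
  assume cap: "two_capturing m n r \<F>"
  have fin: "{A. A \<subseteq> UNIV \<and> finite A} \<subseteq> clash_ideal"
    by (auto simp: clash_ideal_def unbounded_clash_def countable_finite)
  have count: "clash_ideal \<subseteq> {A. countable A}" by (auto simp: clash_ideal_def)
  from assms P_ideal_clash_ideal fin count show False
  proof (cases rule: P_ideal_dichotomyE)
    case (inside Y f)
    have "uncountable Y"
      using inside(2) uncountable_omega1 by (metis bij_betw_imp_inj_on bij_betw_imp_surj_on countable_image_inj_on)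
    then show False using no_uncountable_in_clash_ideal[OF cap] inside(3) by blast
  next
    case (orthogonal \<C>)
    then have "\<forall>Z\<in>\<C>. countable Z" using orth_clash_ideal_countable[OF cap] by blast
    then have "countable (\<Union>Z\<in>\<C>. Z)" using orthogonal(1) by (intro countable_UN) simp_all
    then have "countable (\<Union>\<C>)" by simp
    then have "countable (UNIV :: omega1 set)" by (simp only: orthogonal(3))
    then show False by (rule notE[OF uncountable_omega1])
  qed
qed

end

theorem mainTheorem19:
  fixes m n r :: "nat \<Rightarrow> nat" and \<F> :: "omega1 set set"
  assumes "\<exists>h :: omega1 \<Rightarrow> 'b. inj h"
    and "\<forall>X :: 'b set. P_ideal_dichotomy_on X"
    and "good_type m n r"
    and "construction_scheme m n r \<F>"
  shows "\<not> two_capturing m n r \<F>"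
proof -
  \<comment> \<open>The dichotomy is assumed for sets over \<open>'b\<close>; its instance for the
    range of \<open>h\<close> is carried back to \<open>omega1\<close>.\<close>
  obtain h :: "omega1 \<Rightarrow> 'b" where "inj h" using assms(1) by blast
  then have "P_ideal_dichotomy_on (UNIV :: omega1 set)"
    using assms(2) P_ideal_dichotomy_inj by blast
  moreover have "scheme m n r \<F>"
    using assms(3,4) by (simp add: scheme_def good_type_def)
  ultimately show ?thesis by (rule scheme.not_two_capturing[rotated])
qed

end
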